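(* For each natural number $\alpha\ge 1$, let $c_\alpha\in(0,\infty)$ be the constant for which $1/c_\alpha$ is the best (smallest) constant $C$ such that $$\int_0^1|u(x)|^2\,dx\le C\int_0^1|u^{(\alpha)}(x)|^2\,dx$$ holds for all $u\in C^\alpha[0,1]$ satisfying $u^{(j)}(0)=u^{(j)}(1)=0$ for $0\le j\le \alpha-1$. Then, as $\alpha\to\infty$ through the natural numbers, $$c_\alpha=\sqrt{8\pi\alpha}\,\left(\frac{4\alpha}{e}\right)^{2\alpha}\left[1+O\left(\frac{1}{\sqrt{\alpha}}\right)\right],$$ and for every natural number $\alpha\ge 1$, $$\frac{4\alpha-2}{4\alpha^2-\alpha}\,\frac{(4\alpha)!\,[\alpha!]^2}{[(2\alpha)!]^2}\;\le\; c_\alpha\;\le\;\frac{4\alpha+1}{2\alpha+1}\,\frac{(4\alpha)!\,[\alpha!]^2}{[(2\alpha)!]^2}.$$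
   Context: Functions are complex-valued and $u^{(j)}$ denotes the $j$-th derivative. The constant $c_\alpha$ is known to arise, with the same value, in each of the following equivalent ways (any of them may be taken as its definition): (i) $c_\alpha=\min \dfrac{\int_0^1|u^{(\alpha)}(x)|^2dx}{\int_0^1|u(x)|^2dx}$, the minimum being over all nonzero smooth functions $u$ on $[0,1]$ satisfying $u^{(j)}(0)=u^{(j)}(1)=0$ for $0\le j\le\alpha-1$; equivalently, $1/c_\alpha$ is the best constant in the inequality in the claim. (ii) $c_\alpha$ is the minimal eigenvalue $\lambda$ of the boundary value problem $(-1)^\alpha u^{(2\alpha)}(x)=\lambda u(x)$ on $[0,1]$, $u^{(j)}(0)=u^{(j)}(1)=0$ for $0\le j\le\alpha-1$. (iii) $1/c_\alpha=\|K_\alpha\|$, the operator norm on $L^2(0,1)$ of the integral operator $(K_\alpha v)(x)=\int_0^1G_\alpha(x,y)v(y)\,dy$, where $G_\alpha$ is the Green kernel of the problem $(-1)^\alpha u^{(2\alpha)}=v$ with the boundary conditions in (ii). Explicitly, $$G_\alpha(x,y)=\frac{x^\alpha y^\alpha}{[(\alpha-1)!]^2}\int_{\max(x,y)}^1\frac{(t-x)^{\alpha-1}(t-y)^{\alpha-1}}{t^{2\alpha}}\,dt\quad\text{for }x+y\ge1,$$ and $G_\alpha(x,y)=G_\alpha(1-x,1-y)$ for $x+y<1$. (iv) For every positive function $b$ on the complex unit circle whose Fourier coefficients $b_k$ satisfy $\sum_{k\in\mathbb{Z}}|k|\,|b_k|<\infty$, the smallest eigenvalue of the $n\times n$ Toeplitz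 matrix $T_n(a)=(a_{j-k})_{j,k=1}^n$, where $a_k$ are the Fourier coefficients of $a(t)=|1-t|^{2\alpha}b(t)$, satisfies $\lim_{n\to\infty}n^{2\alpha}\lambda_{\min}(T_n(a))=c_\alpha\, b(1)$. (v) Given $y=(y_1,\dots,y_n)\in\mathbb{C}^n$, put $\delta_k=\sum_{i=0}^{\alpha}(-1)^i\binom{\alpha}{i}y_{k+i}$ for $1\le k\le n-\alpha$, $D(y)=\big(\sum_{k=1}^{n-\alpha}|\delta_k|^2\big)^{1/2}$, and $E(y)=\min_p\big(\sum_{j=1}^n|y_j-p(j)|^2\big)^{1/2}$, the minimum being over all polynomials $p$ of degree at most $\alpha-1$. Then $\max_{D(y)\ne0}E(y)/D(y)$ is asymptotically equal to $n^\alpha/\sqrt{c_\alpha}$ as $n\to\infty$ (ratio tending to $1$). *)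

theory Defs
  imports "HOL-Analysis.Analysis" "HOL-Library.Landau_Symbols"
begin

text \<open>Derivatives on the closed unit interval, one-sided at the endpoints. Only the values
  of \<open>u\<close> on \<open>{0..1}\<close> matter for the values of \<open>nderiv01 j u\<close> on \<open>{0..1}\<close>.\<close>

primrec nderiv01 :: "nat \<Rightarrow> (real \<Rightarrow> complex) \<Rightarrow> real \<Rightarrow> complex" where
  "nderiv01 0 u = u"
| "nderiv01 (Suc j) u = (\<lambda>x. vector_derivative (nderiv01 j u) (at x within {0..1}))"

definition Ck01 :: "nat \<Rightarrow> (real \<Rightarrow> complex) \<Rightarrow> bool" where
  "Ck01 k u \<longleftrightarrow>
     (\<forall>j<k. nderiv01 j u differentiable_on {0..1}) \<and> continuous_on {0..1} (nderiv01 k u)"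

definition dirichlet01 :: "nat \<Rightarrow> (real \<Rightarrow> complex) \<Rightarrow> bool" where
  "dirichlet01 \<alpha> u \<longleftrightarrow> (\<forall>j<\<alpha>. nderiv01 j u 0 = 0 \<and> nderiv01 j u 1 = 0)"

definition wirtinger_bound :: "nat \<Rightarrow> real \<Rightarrow> bool" where
  "wirtinger_bound \<alpha> C \<longleftrightarrow>
     (\<forall>u. Ck01 \<alpha> u \<and> dirichlet01 \<alpha> u \<longrightarrow>
        integral {0..1} (\<lambda>x. (cmod (u x))\<^sup>2)
          \<le> C * integral {0..1} (\<lambda>x. (cmod (nderiv01 \<alpha> u x))\<^sup>2))"

definition c_const :: "nat \<Rightarrow> real" where
  "c_const \<alpha> = 1 / (LEAST C. wirtinger_bound \<alpha> C)"

end

(* The trial function x^a (1-x)^a gives the upper bound for c_a. For the lower bound, put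
   theta = (1-t) d/dt and h = u / (1-t)^a. Then u^(a) and w = (1-t)^a h^(a) are both of the form
   (product of a factors theta + c) h, where the constants of one product are obtained from those
   of the other by c |-> -1 - c up to order. Integration by parts shows that (theta + c) f and
   (theta - 1 - c) f have the same L^2 norm if f vanishes at 0, so w and u^(a) have the same norm.
   Taylor's formula for h at 0 and the Cauchy-Schwarz inequality now give the pointwise bound
   |u(x)|^2 <= (x(1-x))^(2a-1) / ((2a-1) (a-1)!^2) * ||u^(a)||^2, whose coefficient is the
   diagonal G_a(x,x) of the Green kernel; integrating it gives 1/c_a <= trace K_a. The two bounds differ by
   a factor 1 + O(1/a), so Stirling's formula yields the asymptotics with error O(1/a). *)
theory Submission
  imports Defs
begin

section \<open>The operators \<open>wder\<close> and functions clamped at both endpoints\<close>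

text \<open>With \<open>\<theta> = (1 - t) d/dt\<close>, this is \<open>(\<theta> + m - 1) \<cdots> (\<theta> + 1) \<theta>\<close> applied to \<open>U j t / (1 - t) ^ (n - j)\<close>,
  where \<open>U j\<close> stands for the \<open>j\<close>-th derivative of \<open>U 0\<close>. Since \<open>\<theta> (wder m j) = wder m (j + 1) + (n - j) wder m j\<close>,
  the recursion needs no derivatives. In particular \<open>wder 0 n\<close> is \<open>U n\<close>, and \<open>wder n 0\<close> is
  \<open>(1 - t) ^ n\<close> times the \<open>n\<close>-th derivative of \<open>U 0 t / (1 - t) ^ n\<close>.\<close>

primrec wder :: "nat \<Rightarrow> (nat \<Rightarrow> real \<Rightarrow> complex) \<Rightarrow> nat \<Rightarrow> nat \<Rightarrow> real \<Rightarrow> complex" where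
  "wder n U 0 = (\<lambda>j t. U j t /\<^sub>R (1 - t) ^ (n - j))"
| "wder n U (Suc m) = (\<lambda>j t. wder n U m (Suc j) t + real (m + (n - j)) *\<^sub>R wder n U m j t)"

text \<open>The whole chain of derivatives is passed as one family \<open>U\<close>, so that the
  calculus below works with \<open>has_vector_derivative\<close> and never with iterated
  \<open>vector_derivative\<close>; \<open>Ck01_clamped\<close> supplies the family from
  \<open>nderiv01\<close>.\<close>

definition clamped :: "nat \<Rightarrow> (nat \<Rightarrow> real \<Rightarrow> complex) \<Rightarrow> bool" where
  "clamped n U \<longleftrightarrow>
     (\<forall>j<n. \<forall>t\<in>{0..1}. (U j has_vector_derivative U (Suc j) t) (at t within {0..1})) \<and>
     continuous_on {0..1} (U n) \<and> (\<forall>j<n. U j 0 = 0 \<and> U j 1 = 0)"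

lemma clamped_derivative:
  "clamped n U \<Longrightarrow> j < n \<Longrightarrow> t \<in> {0..1} \<Longrightarrow>
     (U j has_vector_derivative U (Suc j) t) (at t within {0..1})"
  by (simp add: clamped_def)

lemma clamped_continuous:
  assumes "clamped n U" "j \<le> n"
  shows "continuous_on {0..1} (U j)"
proof (cases "j = n")
  case False
  then show ?thesis
    using assms by (intro continuous_on_vector_derivative[of _ _ "U (Suc j)"]) (auto simp: clamped_def)
qed (use assms in \<open>auto simp: clamped_def\<close>)

lemma inverse_power_derivative:
  fixes t :: real
  assumes "t \<noteq> 1"
  shows "((\<lambda>t. inverse ((1 - t) ^ k)) has_real_derivative real k * inverse ((1 - t) ^ Suc k)) (at t within S)"
proof (cases k)
  case (Suc l)
  have "((\<lambda>t. (1 - t) ^ Suc l) has_real_derivative - (real (Suc l) * (1 - t) ^ l)) (at t within S)"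
    using DERIV_power[OF DERIV_diff[OF DERIV_const[of 1] DERIV_ident], of "Suc l"] by simp
  then have "((\<lambda>t. inverse ((1 - t) ^ Suc l)) has_real_derivative
      - (- (real (Suc l) * (1 - t) ^ l) * inverse (((1 - t) ^ Suc l) ^ Suc (Suc 0)))) (at t within S)"
    using assms by (intro DERIV_inverse_fun) auto
  moreover have "- (- (r * d ^ l) * inverse ((d ^ Suc l) ^ Suc (Suc 0))) = r * inverse (d ^ Suc (Suc l))"
    if "d \<noteq> 0" for r d :: real
    using that by (simp add: field_simps)
  ultimately show ?thesis
    unfolding Suc using assms by (metis eq_iff_diff_eq_0)
qed simp

text \<open>Dividing the recursion for theta by \<open>1 - t\<close> turns it into an ordinary
  derivative. The condition \<open>m + j < n\<close> ensures that differentiation leads no further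
  than \<open>U n\<close>.\<close>

lemma wder_has_vector_derivative:
  assumes "clamped n U" "m + j < n" "0 \<le> t" "t < 1"
  shows "(wder n U m j has_vector_derivative
           (wder n U m (Suc j) t + real (n - j) *\<^sub>R wder n U m j t) /\<^sub>R (1 - t)) (at t within {0..1})"
  using assms(2)
proof (induction m arbitrary: j)
  case 0
  then obtain k where k: "n - j = Suc k" "n - Suc j = k"
    by (metis Suc_diff_Suc add_0)
  have U: "(U j has_vector_derivative U (Suc j) t) (at t within {0..1})"
    using 0 assms by (auto intro: clamped_derivative)
  note p = inverse_power_derivative[OF less_imp_neq[OF \<open>t < 1\<close>], of "Suc k" "{0..1}"]
  have "((\<lambda>t. inverse ((1 - t) ^ Suc k) *\<^sub>R U j t) has_vector_derivative
         inverse ((1 - t) ^ Suc k) *\<^sub>R U (Suc j) t +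
         (real (Suc k) * inverse ((1 - t) ^ Suc (Suc k))) *\<^sub>R U j t) (at t within {0..1})"
    by (rule has_vector_derivative_scaleR[OF p U])
  then show ?case
    by (simp add: k scaleR_add_right mult_ac)
next
  case (Suc m)
  from Suc.prems have r: "real (n - j) = real (n - Suc j) + 1"
    by simp
  have "(wder n U (Suc m) j has_vector_derivative
      (wder n U m (Suc (Suc j)) t + real (n - Suc j) *\<^sub>R wder n U m (Suc j) t) /\<^sub>R (1 - t) +
      real (m + (n - j)) *\<^sub>R ((wder n U m (Suc j) t + real (n - j) *\<^sub>R wder n U m j t) /\<^sub>R (1 - t)))
      (at t within {0..1})"
    unfolding wder.simps(2) using Suc.prems
    by (intro has_vector_derivative_add Suc.IH
          bounded_linear.has_vector_derivative[OF bounded_linear_scaleR_right]) auto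
  \<comment> \<open>Passing from \<open>j\<close> to \<open>Suc j\<close> lowers
    \<open>n - j\<close> by one, so \<open>wder n U m (Suc j)\<close> has the coefficient m + 2 (n -
    j) - 1 on both sides.\<close>
  also have "(wder n U m (Suc (Suc j)) t + real (n - Suc j) *\<^sub>R wder n U m (Suc j) t) /\<^sub>R (1 - t) +
      real (m + (n - j)) *\<^sub>R ((wder n U m (Suc j) t + real (n - j) *\<^sub>R wder n U m j t) /\<^sub>R (1 - t))
     = (wder n U (Suc m) (Suc j) t + real (n - j) *\<^sub>R wder n U (Suc m) j t) /\<^sub>R (1 - t)"
    using r by (simp add: algebra_simps scaleR_conv_of_real)
  finally show ?case .
qed

lemma wder_continuous:
  assumes "clamped n U" "m + j \<le> n" "x < 1"
  shows "continuous_on {0..x} (wder n U m j)"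
  using assms(2)
proof (induction m arbitrary: j)
  case 0
  have "continuous_on {0..x} (U j)"
    by (rule continuous_on_subset[OF clamped_continuous[OF assms(1)]]) (use 0 assms in auto)
  then show ?case
    using assms(3) by (auto intro!: continuous_intros)
next
  case (Suc m)
  then show ?case
    by (auto intro!: continuous_intros)
qed

text \<open>Since \<open>U j\<close> vanishes at 1 for \<open>j < n\<close>, each integration of
  \<open>U (Suc j)\<close> from \<open>t\<close> to 1 gains a factor \<open>1 - t\<close>, starting
  from the bounded function \<open>U n\<close>. This decay compensates the denominators in
  \<open>wder\<close>.\<close>

lemma clamped_bound:
  assumes "clamped n U"
  obtains M where "M \<ge> 0" "\<And>j t. j \<le> n \<Longrightarrow> t \<in> {0..1} \<Longrightarrow> norm (U j t) \<le> M * (1 - t) ^ (n - j)"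
proof -
  have "bounded (U n ` {0..1})"
    by (intro compact_imp_bounded compact_continuous_image clamped_continuous[OF assms]) auto
  then obtain M where M: "\<And>t. t \<in> {0..1} \<Longrightarrow> norm (U n t) \<le> M"
    unfolding bounded_iff by blast
  have "M \<ge> 0"
    using order_trans[OF norm_ge_zero M[of 0]] by simp
  have "norm (U (n - k) t) \<le> M * (1 - t) ^ k" if "k \<le> n" "t \<in> {0..1}" for k t
    using that
  proof (induction k arbitrary: t)
    case 0
    then show ?case using M by simp
  next
    case (Suc k)
    define j where "j = n - Suc k"
    have j: "j < n" "Suc j = n - k"
      using Suc.prems by (auto simp: j_def)
    have "(U (Suc j) has_integral U j 1 - U j t) {t..1}"
    proof (rule fundamental_theorem_of_calculus)
      fix s assume "s \<in> {t..1}"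
      then show "(U j has_vector_derivative U (Suc j) s) (at s within {t..1})"
        using Suc.prems
        by (intro has_vector_derivative_within_subset[OF clamped_derivative[OF assms j(1)]]) auto
    qed (use Suc.prems in auto)
    moreover have "norm (U (Suc j) s) \<le> M * (1 - t) ^ k" if "s \<in> {t..1}" for s
    proof -
      have "norm (U (Suc j) s) \<le> M * (1 - s) ^ k"
        unfolding j using that Suc.prems by (intro Suc.IH) auto
      also have "\<dots> \<le> M * (1 - t) ^ k"
        using that \<open>M \<ge> 0\<close> by (intro mult_left_mono power_mono) auto
      finally show ?thesis .
    qed
    ultimately have "norm (U j 1 - U j t) \<le> (M * (1 - t) ^ k) * measure lborel {t..1}"
      using \<open>M \<ge> 0\<close> Suc.prems by (intro has_integral_bound_real) auto
    moreover have "U j 1 = 0"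
      using assms j(1) by (simp add: clamped_def)
    ultimately show ?case
      using Suc.prems by (simp add: j_def mult_ac)
  qed
  from this[of "n - j" for j] show ?thesis
    using \<open>M \<ge> 0\<close> by (intro that[of M]) (metis diff_diff_cancel diff_le_self)+
qed


text \<open>By \<open>clamped_bound\<close> the denominator of \<open>wder n U 0 j\<close> cancels,
  and the recursion preserves boundedness. This makes the boundary terms of the energy comparison
  vanish at 1.\<close>

lemma wder_bounded:
  assumes "clamped n U" "m + j \<le> n"
  obtains K where "\<And>t. 0 \<le> t \<Longrightarrow> t < 1 \<Longrightarrow> norm (wder n U m j t) \<le> K"
proof -
  obtain M where M: "\<And>j t. j \<le> n \<Longrightarrow> t \<in> {0..1} \<Longrightarrow> norm (U j t) \<le> M * (1 - t) ^ (n - j)"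
    using clamped_bound[OF assms(1)] by metis
  have "\<exists>K. \<forall>t. 0 \<le> t \<longrightarrow> t < 1 \<longrightarrow> norm (wder n U m j t) \<le> K"
    using assms(2)
  proof (induction m arbitrary: j)
    case 0
    have "norm (wder n U 0 j t) \<le> M" if "0 \<le> t" "t < 1" for t
      using M[of j t] that 0 by (simp add: field_simps norm_power)
    then show ?case by blast
  next
    case (Suc m)
    obtain K1 where K1: "\<And>t. 0 \<le> t \<Longrightarrow> t < 1 \<Longrightarrow> norm (wder n U m (Suc j) t) \<le> K1"
      using Suc.IH[of "Suc j"] Suc.prems by auto
    obtain K2 where K2: "\<And>t. 0 \<le> t \<Longrightarrow> t < 1 \<Longrightarrow> norm (wder n U m j t) \<le> K2"
      using Suc.IH[of j] Suc.prems by auto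
    have "norm (wder n U (Suc m) j t) \<le> K1 + real (m + (n - j)) * K2" if t: "0 \<le> t" "t < 1" for t
    proof -
      have "norm (wder n U (Suc m) j t) \<le>
          norm (wder n U m (Suc j) t) + norm (real (m + (n - j)) *\<^sub>R wder n U m j t)"
        unfolding wder.simps(2) by (rule norm_triangle_ineq)
      also have "\<dots> = norm (wder n U m (Suc j) t) + real (m + (n - j)) * norm (wder n U m j t)"
        by simp
      also have "\<dots> \<le> K1 + real (m + (n - j)) * K2"
        by (intro add_mono mult_left_mono K1 K2 t) auto
      finally show ?thesis .
    qed
    then show ?case by blast
  qed
  then show ?thesis using that by blast
qed

section \<open>Energy comparison along the antidiagonal\<close>

lemma wder_0:
  assumes "clamped n U" "m + j < n"
  shows "wder n U m j 0 = 0"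
  using assms(2) by (induction m arbitrary: j) (use assms(1) in \<open>auto simp: clamped_def\<close>)

text \<open>The integrand is the derivative of \<open>(2 m + 1) (1 - t) |wder m j|\<^sup>2\<close>; summing over the antidiagonal
  \<open>m + j = n\<close> compares \<open>wder n 0\<close> with \<open>wder 0 n\<close>.\<close>

lemma wder_energy_step:
  assumes "clamped n U" "Suc (m + j) = n" "0 \<le> y" "y < 1"
  shows "((\<lambda>t. (norm (wder n U (Suc m) j t))\<^sup>2 - (norm (wder n U m (Suc j) t))\<^sup>2) has_integral
           real (2 * m + 1) * (1 - y) * (norm (wder n U m j y))\<^sup>2) {0..y}"
proof -
  define e where "e = wder n U m j"
  define f where "f = wder n U m (Suc j)"
  have nj: "n - j = Suc m"
    using assms by auto
  have "((\<lambda>t. (norm (wder n U (Suc m) j t))\<^sup>2 - (norm (wder n U m (Suc j) t))\<^sup>2) has_integral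
      (1 - y) * (real (2 * m + 1) * (e y \<bullet> e y)) - (1 - 0) * (real (2 * m + 1) * (e 0 \<bullet> e 0))) {0..y}"
  proof (rule fundamental_theorem_of_calculus)
    fix t assume t: "t \<in> {0..y}"
    have d: "(e has_vector_derivative (f t + real (Suc m) *\<^sub>R e t) /\<^sub>R (1 - t)) (at t within {0..y})"
      unfolding e_def f_def using t assms nj
      by (intro has_vector_derivative_within_subset[OF wder_has_vector_derivative[OF assms(1), of m j t, unfolded nj]]) auto
    have l: "((\<lambda>t. 1 - t) has_real_derivative - 1) (at t within {0..y})"
      by (auto intro!: derivative_eq_intros)
    have "((\<lambda>t. (1 - t) *\<^sub>R (real (2 * m + 1) *\<^sub>R (e t \<bullet> e t))) has_vector_derivative
       (1 - t) *\<^sub>R (real (2 * m + 1) *\<^sub>R (e t \<bullet> ((f t + real (Suc m) *\<^sub>R e t) /\<^sub>R (1 - t)) +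
         ((f t + real (Suc m) *\<^sub>R e t) /\<^sub>R (1 - t)) \<bullet> e t)) + (- 1) *\<^sub>R (real (2 * m + 1) *\<^sub>R (e t \<bullet> e t)))
       (at t within {0..y})"
      by (intro has_vector_derivative_scaleR[OF l]
          bounded_linear.has_vector_derivative[OF bounded_linear_scaleR_right]
          bounded_bilinear.has_vector_derivative[OF bounded_bilinear_inner] d)
    moreover have "(norm (wder n U (Suc m) j t))\<^sup>2 - (norm (wder n U m (Suc j) t))\<^sup>2 =
       (1 - t) *\<^sub>R (real (2 * m + 1) *\<^sub>R (e t \<bullet> ((f t + real (Suc m) *\<^sub>R e t) /\<^sub>R (1 - t)) +
         ((f t + real (Suc m) *\<^sub>R e t) /\<^sub>R (1 - t)) \<bullet> e t)) + (- 1) *\<^sub>R (real (2 * m + 1) *\<^sub>R (e t \<bullet> e t))"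
    proof -
      \<comment> \<open>On the antidiagonal \<open>n - j = Suc m\<close>, so the recursion adds (2 m
        + 1) e to f, while theta e = f + (m + 1) e. With these coefficients both sides become 2 (2 m
        + 1) p + (2 m + 1)^2 q.\<close>
      define p q where "p = e t \<bullet> f t" and "q = e t \<bullet> e t"
      have e: "wder n U (Suc m) j t = f t + real (2 * m + 1) *\<^sub>R e t" "wder n U m (Suc j) t = f t"
        using nj by (simp_all add: e_def f_def)
      have "(norm (f t + r *\<^sub>R e t))\<^sup>2 - (norm (f t))\<^sup>2 = 2 * r * p + r * r * q" for r
        unfolding power2_norm_eq_inner p_def q_def
        by (simp add: inner_add_left inner_add_right inner_commute[of "f t" "e t"] distrib_left)
      then have l: "(norm (wder n U (Suc m) j t))\<^sup>2 - (norm (wder n U m (Suc j) t))\<^sup>2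
          = 2 * real (2 * m + 1) * p + real (2 * m + 1) * real (2 * m + 1) * q"
        by (simp only: e)
      have r: "e t \<bullet> ((f t + r *\<^sub>R e t) /\<^sub>R d) = (p + r * q) / d" "((f t + r *\<^sub>R e t) /\<^sub>R d) \<bullet> e t = (p + r * q) / d" for r d
        unfolding p_def q_def
        by (simp_all add: inner_add_left inner_add_right inner_commute[of "f t" "e t"] divide_inverse mult.commute)
      have "d * (R * (X / d + X / d)) = 2 * R * X" if "d > 0" for d R X :: real
        using that by (simp add: field_simps)
      from this[of "1 - t"] have c: "(1 - t) * (R * (X / (1 - t) + X / (1 - t))) = 2 * R * X" for R X
        using t assms by auto
      show ?thesis
        unfolding l r real_scaleR_def c q_def[symmetric] by (simp add: algebra_simps)
    qed
    ultimately show "((\<lambda>t. (1 - t) * (real (2 * m + 1) * (e t \<bullet> e t))) has_vector_derivative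
      (norm (wder n U (Suc m) j t))\<^sup>2 - (norm (wder n U m (Suc j) t))\<^sup>2) (at t within {0..y})"
      by (simp add: mult.assoc)
  qed (use assms in auto)
  moreover have "e 0 = 0"
    using assms unfolding e_def by (intro wder_0) auto
  ultimately show ?thesis
    by (simp add: e_def power2_norm_eq_inner mult_ac)
qed

lemma wder_square_integrable:
  assumes "clamped n U" "m + j \<le> n" "x < 1"
  shows "(\<lambda>t. (norm (wder n U m j t))\<^sup>2) integrable_on {0..x}"
  by (intro integrable_continuous_interval continuous_intros wder_continuous[OF assms])

text \<open>The energy steps telescope from \<open>wder n U 0 n\<close>, which is
  \<open>U n\<close>. Each contributes a boundary term at \<open>y\<close> of at most a constant
  times \<open>1 - y\<close>, because \<open>wder\<close> is bounded.\<close>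

lemma wder_energy_near_1:
  assumes "clamped n U" "k \<le> n"
  obtains K where "K \<ge> 0" "\<And>y. 0 \<le> y \<Longrightarrow> y < 1 \<Longrightarrow>
    integral {0..y} (\<lambda>t. (norm (wder n U k (n - k) t))\<^sup>2) \<le>
      integral {0..y} (\<lambda>t. (norm (U n t))\<^sup>2) + K * (1 - y)"
proof -
  have "\<exists>K\<ge>0. \<forall>y. 0 \<le> y \<longrightarrow> y < 1 \<longrightarrow>
    integral {0..y} (\<lambda>t. (norm (wder n U k (n - k) t))\<^sup>2) \<le>
      integral {0..y} (\<lambda>t. (norm (U n t))\<^sup>2) + K * (1 - y)"
    using assms(2)
  proof (induction k)
    case 0
    show ?case by (intro exI[of _ 0]) auto
  next
    case (Suc k)
    then obtain K where K: "K \<ge> 0" "\<And>y. 0 \<le> y \<Longrightarrow> y < 1 \<Longrightarrow>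
      integral {0..y} (\<lambda>t. (norm (wder n U k (n - k) t))\<^sup>2) \<le>
      integral {0..y} (\<lambda>t. (norm (U n t))\<^sup>2) + K * (1 - y)"
      by auto
    define j where "j = n - Suc k"
    have j: "Suc (k + j) = n" "n - k = Suc j"
      using Suc.prems by (auto simp: j_def)
    obtain L where L: "\<And>t. 0 \<le> t \<Longrightarrow> t < 1 \<Longrightarrow> norm (wder n U k j t) \<le> L"
      using wder_bounded[OF assms(1), of k j] j by auto
    have "integral {0..y} (\<lambda>t. (norm (wder n U (Suc k) j t))\<^sup>2) \<le>
      integral {0..y} (\<lambda>t. (norm (U n t))\<^sup>2) + (K + real (2 * k + 1) * L\<^sup>2) * (1 - y)"
      if y: "0 \<le> y" "y < 1" for y
    proof -
      have "integral {0..y} (\<lambda>t. (norm (wder n U (Suc k) j t))\<^sup>2)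
          - integral {0..y} (\<lambda>t. (norm (wder n U k (Suc j) t))\<^sup>2)
          = real (2 * k + 1) * (1 - y) * (norm (wder n U k j y))\<^sup>2"
        using integral_unique[OF wder_energy_step[OF assms(1) j(1) y]] y j(1)
        by (subst Henstock_Kurzweil_Integration.integral_diff[symmetric])
           (use assms(1) in \<open>auto intro!: wder_square_integrable simp del: wder.simps\<close>)
      also have "\<dots> \<le> real (2 * k + 1) * (1 - y) * L\<^sup>2"
        using y L by (intro mult_left_mono power_mono) auto
      finally show ?thesis
        using K(2)[OF y] j by (simp add: algebra_simps del: wder.simps)
    qed
    then show ?case
      using K(1) unfolding j_def by (intro exI[of _ "K + real (2 * k + 1) * L\<^sup>2"]) (auto simp del: wder.simps)
  qed
  then show ?thesis using that by blast
qed

text \<open>Enlarging the range from \<open>x\<close> to \<open>y\<close> increases the left side,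
  and the error \<open>K * (1 - y)\<close> disappears as \<open>y\<close> tends to 1. Stopping at
  \<open>x < 1\<close> keeps away from the point where the denominators of \<open>wder\<close>
  vanish.\<close>

lemma wder_energy_le:
  assumes "clamped n U" "0 \<le> x" "x < 1"
  shows "integral {0..x} (\<lambda>t. (norm (wder n U n 0 t))\<^sup>2) \<le> integral {0..1} (\<lambda>t. (norm (U n t))\<^sup>2)"
proof -
  obtain K where K: "K \<ge> 0" "\<And>y. 0 \<le> y \<Longrightarrow> y < 1 \<Longrightarrow>
    integral {0..y} (\<lambda>t. (norm (wder n U n 0 t))\<^sup>2) \<le>
      integral {0..y} (\<lambda>t. (norm (U n t))\<^sup>2) + K * (1 - y)"
    using wder_energy_near_1[OF assms(1), of n] by auto
  have U: "(\<lambda>t. (norm (U n t))\<^sup>2) integrable_on {0..1}"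
    by (intro integrable_continuous_interval continuous_intros clamped_continuous[OF assms(1)]) auto
  have "integral {0..x} (\<lambda>t. (norm (wder n U n 0 t))\<^sup>2) \<le>
      integral {0..1} (\<lambda>t. (norm (U n t))\<^sup>2) + K * (1 - y)" if y: "x \<le> y" "y < 1" for y
  proof -
    have "integral {0..x} (\<lambda>t. (norm (wder n U n 0 t))\<^sup>2) \<le>
        integral {0..y} (\<lambda>t. (norm (wder n U n 0 t))\<^sup>2)"
      using y assms by (intro integral_subset_le wder_square_integrable) auto
    moreover have "integral {0..y} (\<lambda>t. (norm (U n t))\<^sup>2) \<le> integral {0..1} (\<lambda>t. (norm (U n t))\<^sup>2)"
      using y assms by (intro integral_subset_le U integrable_on_subinterval[OF U]) auto
    ultimately show ?thesis
      using K(2)[of y] y assms by auto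
  qed
  then have "eventually (\<lambda>y. integral {0..x} (\<lambda>t. (norm (wder n U n 0 t))\<^sup>2) \<le>
      integral {0..1} (\<lambda>t. (norm (U n t))\<^sup>2) + K * (1 - y)) (at_left 1)"
    using assms by (auto simp: eventually_at_left_field intro!: exI[of _ x])
  moreover have "((\<lambda>y. integral {0..1} (\<lambda>t. (norm (U n t))\<^sup>2) + K * (1 - y)) \<longlongrightarrow>
      integral {0..1} (\<lambda>t. (norm (U n t))\<^sup>2) + K * (1 - 1)) (at_left 1)"
    by (intro tendsto_intros)
  ultimately show ?thesis
    by (intro tendsto_lowerbound[of _ _ "at_left (1::real)"]) auto
qed

section \<open>Cauchy-Schwarz, Taylor's formula and the pointwise bound\<close>

lemma Cauchy_Schwarz_integral:
  fixes f g :: "real \<Rightarrow> real"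
  assumes "(\<lambda>t. (f t)\<^sup>2) integrable_on S" "(\<lambda>t. (g t)\<^sup>2) integrable_on S" "(\<lambda>t. f t * g t) integrable_on S"
  shows "(integral S (\<lambda>t. f t * g t))\<^sup>2 \<le> integral S (\<lambda>t. (f t)\<^sup>2) * integral S (\<lambda>t. (g t)\<^sup>2)"
proof -
  define A B C where "A = integral S (\<lambda>t. (f t)\<^sup>2)" and "B = integral S (\<lambda>t. f t * g t)"
    and "C = integral S (\<lambda>t. (g t)\<^sup>2)"
  have q: "0 \<le> a\<^sup>2 * A + b\<^sup>2 * C - 2 * a * b * B" for a b
  proof -
    have "((\<lambda>t. a\<^sup>2 * (f t)\<^sup>2 + b\<^sup>2 * (g t)\<^sup>2 - 2 * a * b * (f t * g t)) has_integral
        a\<^sup>2 * A + b\<^sup>2 * C - 2 * a * b * B) S"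
      unfolding A_def B_def C_def
      by (intro has_integral_add has_integral_diff has_integral_mult_right integrable_integral assms)
    moreover have "a\<^sup>2 * (f t)\<^sup>2 + b\<^sup>2 * (g t)\<^sup>2 - 2 * a * b * (f t * g t) = (a * f t - b * g t)\<^sup>2" for t
      by (simp add: power2_eq_square algebra_simps)
    ultimately have "((\<lambda>t. (a * f t - b * g t)\<^sup>2) has_integral a\<^sup>2 * A + b\<^sup>2 * C - 2 * a * b * B) S"
      by (simp only:)
    then show ?thesis
      by (rule has_integral_nonneg) simp
  qed
  have "A \<ge> 0" "C \<ge> 0"
    using q[of 1 0] q[of 0 1] by auto
  have "B\<^sup>2 \<le> A * C"
  proof (cases "A = 0")
    case True
    have "B = 0"
    proof (rule ccontr)
      assume "B \<noteq> 0"
      \<comment> \<open>For \<open>A = 0\<close> this choice turns the quadratic form into C - (C +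
        1) = -1.\<close>
      with q[of "(C + 1) / (2 * B)" 1] True show False by simp
    qed
    with True show ?thesis by simp
  next
    case False
    with \<open>A \<ge> 0\<close> have "A > 0" by simp
    have "0 \<le> B\<^sup>2 * A + A\<^sup>2 * C - 2 * B * A * B"
      using q[of B A] .
    also have "\<dots> = A * (A * C - B\<^sup>2)"
      by (simp add: power2_eq_square algebra_simps)
    finally show ?thesis
      using \<open>A > 0\<close> by (simp add: zero_le_mult_iff)
  qed
  then show ?thesis
    by (simp add: A_def B_def C_def)
qed

text \<open>This is the squared Taylor kernel weighted by the denominators of h. Multiplied by
  \<open>(1 - x) ^ (2 * n)\<close> and divided by the square of \<open>fact (n - 1)\<close>, the
  integral is the diagonal value G_n(x,x) of the Green kernel.\<close>

lemma has_integral_truncated_kernel: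
  assumes "n \<ge> 1" "0 \<le> x" "x < 1"
  shows "((\<lambda>t. ((x - t) ^ (n - 1) / (1 - t) ^ n)\<^sup>2) has_integral
           x ^ (2 * n - 1) / (real (2 * n - 1) * (1 - x))) {0..x}"
proof -
  obtain k where k: "n = Suc k"
    using assms(1) by (cases n) auto
  \<comment> \<open>An antiderivative comes from the substitution \<open>s = (x - t) / (1 - t)\<close>.\<close>
  define c where "c = - 1 / (real (2 * k + 1) * (1 - x))"
  have "((\<lambda>t. ((x - t) ^ (n - 1) / (1 - t) ^ n)\<^sup>2) has_integral
     c * ((x - x) / (1 - x)) ^ (2 * k + 1) - c * ((x - 0) / (1 - 0)) ^ (2 * k + 1)) {0..x}"
  proof (rule fundamental_theorem_of_calculus)
    fix t assume t: "t \<in> {0..x}"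
    have "((\<lambda>t. (x - t) / (1 - t)) has_real_derivative (- (1 - x)) / (1 - t)\<^sup>2) (at t within {0..x})"
      using t assms by (auto intro!: derivative_eq_intros simp: power2_eq_square algebra_simps)
    from DERIV_cmult[OF DERIV_power[OF this, of "2 * k + 1"], of c]
    have "((\<lambda>t. c * ((x - t) / (1 - t)) ^ (2 * k + 1)) has_real_derivative
       c * (real (2 * k + 1) * ((x - t) / (1 - t)) ^ (2 * k) * ((- (1 - x)) / (1 - t)\<^sup>2)))
       (at t within {0..x})"
      by (simp add: mult_ac)
    moreover have kernel_simp: "- 1 / (q * d) * (q * P * (- d / D)) = P / D" if "q > 0" "d > 0" for q d P D :: real
      using that by (cases "D = 0") (auto simp: field_simps)
    then have "c * (real (2 * k + 1) * ((x - t) / (1 - t)) ^ (2 * k) * (- (1 - x) / (1 - t)\<^sup>2))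
        = ((x - t) / (1 - t)) ^ (2 * k) / (1 - t)\<^sup>2"
      unfolding c_def using assms by (intro kernel_simp) auto
    ultimately have "((\<lambda>t. c * ((x - t) / (1 - t)) ^ (2 * k + 1)) has_real_derivative
        ((x - t) / (1 - t)) ^ (2 * k) / (1 - t)\<^sup>2) (at t within {0..x})"
      by (simp only:)
    also have "((x - t) / (1 - t)) ^ (2 * k) / (1 - t)\<^sup>2 = ((x - t) ^ (n - 1) / (1 - t) ^ n)\<^sup>2"
      by (simp add: k power_divide power_mult_distrib power_mult[of _ k 2, symmetric] power2_eq_square mult_ac
          flip: power_add mult_2)
    finally show "((\<lambda>t. c * ((x - t) / (1 - t)) ^ (2 * k + 1)) has_vector_derivative
        ((x - t) ^ (n - 1) / (1 - t) ^ n)\<^sup>2) (at t within {0..x})"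
      by (simp add: has_real_derivative_iff_has_vector_derivative)
  qed (use assms in auto)
  then show ?thesis
    by (simp add: c_def k)
qed

lemma clamped_pointwise_bound:
  assumes "clamped n U" "n \<ge> 1" "x \<in> {0..1}"
  shows "(norm (U 0 x))\<^sup>2 \<le>
    (x * (1 - x)) ^ (2 * n - 1) / (real (2 * n - 1) * (fact (n - 1))\<^sup>2) * integral {0..1} (\<lambda>t. (norm (U n t))\<^sup>2)"
\<comment> \<open>The quotient h has a zero denominator at 1, but there both sides of the bound are
  0.\<close>
proof (cases "x = 1")
  case True
  then show ?thesis
    using assms by (simp add: clamped_def power_0_left)
next
  case False
  then have x: "0 \<le> x" "x < 1"
    using assms by auto
  define I where "I = integral {0..1} (\<lambda>t. (norm (U n t))\<^sup>2)"
  define w where "w = wder n U n 0"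
  \<comment> \<open>\<open>v m\<close> is the m-th derivative of h =
    \<open>U 0 t / (1 - t) ^ n\<close>. The kernel \<open>k\<close> below absorbs the factor (1 -
    t)^(-n) by which \<open>v n\<close> differs from \<open>w\<close>.\<close>
  define v where "v = (\<lambda>m t. inverse ((1 - t) ^ m) *\<^sub>R wder n U m 0 t)"
  define k where "k = (\<lambda>t. (x - t) ^ (n - 1) / (1 - t) ^ n)"
  have der: "(v m has_vector_derivative v (Suc m) t) (at t within {0..x})"
    if m: "m < n" and t: "0 \<le> t" "t \<le> x" for m t
  proof -
    have t1: "t < 1" "t \<noteq> 1"
      using t x by auto
    have "(wder n U m 0 has_vector_derivative
        (wder n U m (Suc 0) t + real (n - 0) *\<^sub>R wder n U m 0 t) /\<^sub>R (1 - t)) (at t within {0..x})"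
      by (rule has_vector_derivative_within_subset[OF wder_has_vector_derivative[OF assms(1)]])
         (use m t t1 x in auto)
    from has_vector_derivative_scaleR[OF inverse_power_derivative[OF t1(2), of m] this]
    have "(v m has_vector_derivative
        inverse ((1 - t) ^ m) *\<^sub>R ((wder n U m (Suc 0) t + real (n - 0) *\<^sub>R wder n U m 0 t) /\<^sub>R (1 - t))
        + (real m * inverse ((1 - t) ^ Suc m)) *\<^sub>R wder n U m 0 t) (at t within {0..x})"
      unfolding v_def .
    also have "inverse ((1 - t) ^ m) *\<^sub>R ((wder n U m (Suc 0) t + real (n - 0) *\<^sub>R wder n U m 0 t) /\<^sub>R (1 - t))
        + (real m * inverse ((1 - t) ^ Suc m)) *\<^sub>R wder n U m 0 t = v (Suc m) t"
      by (simp add: v_def scaleR_add_right scaleR_add_left distrib_left distrib_right mult_ac)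
    finally show ?thesis .
  qed
  have "((\<lambda>t. ((x - t) ^ (n - 1) / fact (n - 1)) *\<^sub>R v n t) has_integral
      v 0 x - (\<Sum>i<n. ((x - 0) ^ i / fact i) *\<^sub>R v i 0)) {0..x}"
    by (rule Taylor_has_integral) (use assms x der in auto)
  \<comment> \<open>The Taylor polynomial of h at 0 vanishes, so only the integral remainder is
    left.\<close>
  moreover have "v i 0 = 0" if "i < n" for i
    using that assms(1) by (simp add: v_def wder_0)
  ultimately have T: "((\<lambda>t. (k t / fact (n - 1)) *\<^sub>R w t) has_integral v 0 x) {0..x}"
    by (simp add: v_def k_def w_def divide_inverse mult_ac)
  have ci: "continuous_on {0..x} k" "continuous_on {0..x} w"
    unfolding k_def w_def using x by (auto intro!: continuous_intros wder_continuous assms)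
  have kw: "(\<lambda>t. k t * norm (w t)) integrable_on {0..x}"
    by (intro integrable_continuous_interval continuous_intros ci)
  have k0: "k t \<ge> 0" if "t \<in> {0..x}" for t
    using that x by (auto simp: k_def)
  have "norm (v 0 x) \<le> integral {0..x} (\<lambda>t. inverse (fact (n - 1)) * (k t * norm (w t)))"
    unfolding integral_unique[OF T, symmetric]
  proof (rule integral_norm_bound_integral)
    show "(\<lambda>t. inverse (fact (n - 1)) * (k t * norm (w t))) integrable_on {0..x}"
      using integrable_on_cmult_left[OF kw] by simp
  qed (use T k0 in \<open>auto simp: has_integral_integrable divide_inverse mult_ac\<close>)
  also have "\<dots> = integral {0..x} (\<lambda>t. k t * norm (w t)) / fact (n - 1)"
    by (simp add: divide_inverse mult.commute)
  finally have "(norm (v 0 x))\<^sup>2 \<le> (integral {0..x} (\<lambda>t. k t * norm (w t)) / fact (n - 1))\<^sup>2"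
    by (intro power_mono) auto
  also have "\<dots> \<le> integral {0..x} (\<lambda>t. (k t)\<^sup>2) * integral {0..x} (\<lambda>t. (norm (w t))\<^sup>2) / (fact (n - 1))\<^sup>2"
    unfolding power_divide
    by (intro divide_right_mono Cauchy_Schwarz_integral kw)
       (auto intro!: integrable_continuous_interval continuous_intros ci)
  also have "integral {0..x} (\<lambda>t. (k t)\<^sup>2) = x ^ (2 * n - 1) / (real (2 * n - 1) * (1 - x))"
    unfolding k_def by (intro integral_unique has_integral_truncated_kernel assms x)
  also have "x ^ (2 * n - 1) / (real (2 * n - 1) * (1 - x)) * integral {0..x} (\<lambda>t. (norm (w t))\<^sup>2) / (fact (n - 1))\<^sup>2
      \<le> x ^ (2 * n - 1) / (real (2 * n - 1) * (1 - x)) * I / (fact (n - 1))\<^sup>2"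
    unfolding w_def I_def using x assms
    by (intro divide_right_mono mult_left_mono wder_energy_le) auto
  \<comment> \<open>Multiplication by \<open>(1 - x) ^ (2 * n)\<close> returns from h to
    \<open>U 0\<close>; one of the factors cancels the \<open>1 - x\<close> in the denominator of
    the kernel integral.\<close>
  finally have "(1 - x) ^ (2 * n) * (norm (v 0 x))\<^sup>2 \<le>
      (1 - x) ^ (2 * n) * (x ^ (2 * n - 1) / (real (2 * n - 1) * (1 - x)) * I / (fact (n - 1))\<^sup>2)"
    using x by (intro mult_left_mono) auto
  moreover have "(1 - x) ^ (2 * n) * (norm (v 0 x))\<^sup>2 = (norm (U 0 x))\<^sup>2"
    using x by (simp add: v_def norm_power power_mult_distrib power_mult[of _ n 2, symmetric] mult.commute field_simps)
  moreover have "(1 - x) ^ (2 * n) = (1 - x) ^ (2 * n - 1) * (1 - x)"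
    using assms(2) by (cases n) auto
  ultimately show ?thesis
    using x unfolding I_def[symmetric] power_mult_distrib by (simp add: mult_ac)
qed

section \<open>The Wirtinger inequality with the trace as constant\<close>

lemma has_integral_symmetric_Beta:
  "((\<lambda>x::real. (x * (1 - x)) ^ k) has_integral (fact k)\<^sup>2 / fact (2 * k + 1)) {0..1}"
proof -
  have "((\<lambda>t. t powr (real (k + 1) - 1) * (1 - t) powr (real (k + 1) - 1)) has_integral
      Beta (real (k + 1)) (real (k + 1))) {0..1}"
    by (rule has_integral_Beta_real) auto
  moreover have "Beta (real (k + 1)) (real (k + 1)) = (fact k)\<^sup>2 / fact (2 * k + 1)"
    using Gamma_fact[of k, where 'a=real] Gamma_fact[of "2 * k + 1", where 'a=real]
    by (simp add: Beta_def power2_eq_square algebra_simps)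
  \<comment> \<open>The open interval is essential for \<open>k = 0\<close>: at the endpoints
    \<open>0 powr 0\<close> is 0, whereas the natural power \<open>0 ^ 0\<close> is 1.\<close>
  ultimately have "((\<lambda>t. t powr (real (k + 1) - 1) * (1 - t) powr (real (k + 1) - 1)) has_integral
      (fact k)\<^sup>2 / fact (2 * k + 1)) {0<..<1}"
    by (simp only: has_integral_Icc_iff_Ioo)
  then show ?thesis
    unfolding has_integral_Icc_iff_Ioo
    by (rule has_integral_eq[rotated]) (auto simp: powr_realpow power_mult_distrib)
qed

text \<open>The pointwise bound is integrated by the Beta integral with exponent
  \<open>2 * n - 1\<close>; the constant is the trace of K_n.\<close>

lemma clamped_Wirtinger:
  assumes "clamped n U" "n \<ge> 1"
  shows "integral {0..1} (\<lambda>t. (norm (U 0 t))\<^sup>2) \<le>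
    (fact (2 * n - 1))\<^sup>2 / (fact (4 * n - 1) * real (2 * n - 1) * (fact (n - 1))\<^sup>2)
      * integral {0..1} (\<lambda>t. (norm (U n t))\<^sup>2)"
proof -
  define I where "I = integral {0..1} (\<lambda>t. (norm (U n t))\<^sup>2)"
  define c where "c = I / (real (2 * n - 1) * (fact (n - 1))\<^sup>2)"
  have n: "2 * (2 * n - 1) + 1 = 4 * n - 1"
    using assms(2) by auto
  have "((\<lambda>x. c * (x * (1 - x)) ^ (2 * n - 1)) has_integral
      c * ((fact (2 * n - 1))\<^sup>2 / fact (2 * (2 * n - 1) + 1))) {0..1}"
    by (intro has_integral_mult_right has_integral_symmetric_Beta)
  moreover have "(\<lambda>t. (norm (U 0 t))\<^sup>2) integrable_on {0..1}"
    by (intro integrable_continuous_interval continuous_intros clamped_continuous[OF assms(1)]) auto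
  moreover have "(norm (U 0 t))\<^sup>2 \<le> c * (t * (1 - t)) ^ (2 * n - 1)" if "t \<in> {0..1}" for t
    using clamped_pointwise_bound[OF assms that] by (simp add: c_def I_def mult_ac)
  ultimately have "integral {0..1} (\<lambda>t. (norm (U 0 t))\<^sup>2) \<le> c * ((fact (2 * n - 1))\<^sup>2 / fact (4 * n - 1))"
    unfolding n by (intro has_integral_le[OF integrable_integral]) auto
  then show ?thesis
    by (simp add: c_def I_def mult_ac)
qed

lemma Ck01_clamped:
  assumes "Ck01 n u" "dirichlet01 n u"
  shows "clamped n (\<lambda>j. nderiv01 j u)"
  using assms
  by (auto simp: clamped_def Ck01_def dirichlet01_def differentiable_on_def vector_derivative_works)

section \<open>The polynomial trial function\<close>

lemma poly_has_integral_pderiv: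
  fixes p :: "real poly"
  shows "((\<lambda>x. poly (pderiv p) x) has_integral poly p 1 - poly p 0) {0..1}"
  by (rule fundamental_theorem_of_calculus)
     (auto intro: has_field_derivative_at_within poly_DERIV
           simp flip: has_real_derivative_iff_has_vector_derivative)

lemma poly_integrable: "(\<lambda>x. poly p x) integrable_on {0..1 :: real}"
  by (intro integrable_continuous_interval continuous_intros)

text \<open>The boundary terms contain only derivatives of \<open>f\<close> of order below
  \<open>k\<close>. These vanish at both endpoints, so \<open>g\<close> may be arbitrary.\<close>

lemma integral_poly_by_parts:
  fixes f g :: "real poly"
  assumes "\<And>j. j < k \<Longrightarrow> poly ((pderiv ^^ j) f) 0 = 0" "\<And>j. j < k \<Longrightarrow> poly ((pderiv ^^ j) f) 1 = 0"
  shows "integral {0..1} (poly ((pderiv ^^ k) f * g)) =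
         (- 1) ^ k * integral {0..1} (poly (f * (pderiv ^^ k) g))"
  using assms
proof (induction k arbitrary: g)
  case (Suc k)
  define F where "F = (pderiv ^^ k) f"
  have "integral {0..1} (\<lambda>x. poly (pderiv (F * g)) x) = 0"
    using poly_has_integral_pderiv[of "F * g"] Suc.prems by (auto simp: F_def dest: integral_unique)
  then have "integral {0..1} (\<lambda>x. poly (F * pderiv g) x + poly (pderiv F * g) x) = 0"
    by (simp add: pderiv_mult mult_ac)
  then have "integral {0..1} (poly (pderiv F * g)) = - integral {0..1} (poly (F * pderiv g))"
    by (subst (asm) Henstock_Kurzweil_Integration.integral_add) (auto simp del: poly_mult intro!: poly_integrable)
  also have "integral {0..1} (poly (F * pderiv g)) =
      (- 1) ^ k * integral {0..1} (poly (f * (pderiv ^^ k) (pderiv g)))"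
    unfolding F_def using Suc.prems by (intro Suc.IH) auto
  finally show ?case
    by (simp add: F_def funpow_swap1 del: poly_mult)
qed simp

lemma power_dvd_pderiv:
  fixes p q :: "real poly"
  assumes "q ^ Suc k dvd p"
  shows "q ^ k dvd pderiv p"
proof -
  from assms obtain r where "p = q ^ Suc k * r"
    by auto
  then have "pderiv p = q ^ Suc k * pderiv r + smult (of_nat (Suc k)) (q ^ k * pderiv q) * r"
    by (simp only: pderiv_mult pderiv_power_Suc mult.commute[of "pderiv (q ^ Suc k)"] mult_smult_left)
       (simp add: mult_ac)
  also have "\<dots> = q ^ k * (q * pderiv r + smult (of_nat (Suc k)) (pderiv q * r))"
    by (simp add: distrib_left mult_ac del: of_nat_Suc)
  finally have "pderiv p = q ^ k * (q * pderiv r + smult (of_nat (Suc k)) (pderiv q * r))" .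
  then show ?thesis
    by simp
qed

lemma power_dvd_higher_pderiv:
  fixes p q :: "real poly"
  assumes "q ^ n dvd p" "j \<le> n"
  shows "q ^ (n - j) dvd (pderiv ^^ j) p"
  using assms(2)
proof (induction j)
  case (Suc j)
  then have "q ^ Suc (n - Suc j) dvd (pderiv ^^ j) p"
    by (simp add: Suc_diff_Suc del: power_Suc)
  then show ?case
    by (simp add: power_dvd_pderiv)
qed (use assms in simp)

definition bump :: "nat \<Rightarrow> real poly" where
  "bump n = [:0, 1, -1:] ^ n"

lemma poly_bump: "poly (bump n) x = (x * (1 - x)) ^ n"
  by (simp add: bump_def algebra_simps)

lemma higher_pderiv_bump_boundary:
  assumes "j < n"
  shows "poly ((pderiv ^^ j) (bump n)) 0 = 0" "poly ((pderiv ^^ j) (bump n)) 1 = 0"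
proof -
  have "[:0, 1, -1:] dvd [:0, 1, -1:] ^ (n - j)"
    using assms by (intro dvd_power) auto
  also have "\<dots> dvd (pderiv ^^ j) (bump n)"
    using assms by (intro power_dvd_higher_pderiv) (auto simp: bump_def)
  finally obtain r where r: "(pderiv ^^ j) (bump n) = [:0, 1, -1:] * r"
    by (elim dvdE)
  show "poly ((pderiv ^^ j) (bump n)) 0 = 0" "poly ((pderiv ^^ j) (bump n)) 1 = 0"
    unfolding r by simp_all
qed

text \<open>\<open>bump n\<close> has degree \<open>2 * n\<close> and leading coefficient
  \<open>(- 1) ^ n\<close>, so only its top term survives.\<close>

lemma higher_pderiv_bump: "(pderiv ^^ (2 * n)) (bump n) = [:(- 1) ^ n * fact (2 * n):]"
proof (rule poly_eqI)
  fix i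
  have deg: "degree (bump n) = 2 * n"
    by (simp add: bump_def degree_power_eq)
  have "lead_coeff (bump n) = (- 1) ^ n"
    unfolding bump_def lead_coeff_power by simp
  then have "coeff (bump n) (2 * n) = (- 1) ^ n"
    by (simp add: deg)
  moreover have "coeff (bump n) (i + 2 * n) = 0" if "i > 0"
    using that by (intro coeff_eq_0) (simp add: deg)
  ultimately show "coeff ((pderiv ^^ (2 * n)) (bump n)) i = coeff [:(- 1) ^ n * fact (2 * n):] i"
    by (cases i) (auto simp: coeff_higher_pderiv pochhammer_fact)
qed

lemma integral_bump: "integral {0..1} (poly (bump n)) = (fact n)\<^sup>2 / fact (2 * n + 1)"
proof -
  have "poly (bump n) = (\<lambda>x. (x * (1 - x)) ^ n)"
    by (rule ext) (rule poly_bump)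
  then show ?thesis
    using integral_unique[OF has_integral_symmetric_Beta[of n]] by (simp only:)
qed

lemma integral_bump_square: "integral {0..1} (poly (bump n * bump n)) = (fact (2 * n))\<^sup>2 / fact (4 * n + 1)"
proof -
  have "bump n * bump n = bump (2 * n)"
    by (simp only: bump_def mult_2 power_add)
  moreover have "2 * (2 * n) + 1 = 4 * n + 1"
    by simp
  ultimately show ?thesis
    using integral_bump[of "2 * n"] by (simp only:)
qed

text \<open>Integration by parts moves all derivatives to one factor, which becomes the constant of
  \<open>higher_pderiv_bump\<close>. The two signs cancel, and what remains is
  \<open>fact (2 * n)\<close> times the Beta integral of \<open>bump n\<close>.\<close>

lemma integral_higher_pderiv_bump_square:
  "integral {0..1} (poly ((pderiv ^^ n) (bump n) * (pderiv ^^ n) (bump n))) = (fact n)\<^sup>2 / real (2 * n + 1)"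
proof -
  have "integral {0..1} (poly ((pderiv ^^ n) (bump n) * (pderiv ^^ n) (bump n))) =
      (- 1) ^ n * integral {0..1} (poly (bump n * (pderiv ^^ n) ((pderiv ^^ n) (bump n))))"
    by (intro integral_poly_by_parts higher_pderiv_bump_boundary)
  also have "(pderiv ^^ n) ((pderiv ^^ n) (bump n)) = [:(- 1) ^ n * fact (2 * n):]"
    using higher_pderiv_bump[of n] by (simp add: mult_2 funpow_add)
  also have "poly (bump n * [:(- 1) ^ n * fact (2 * n):]) = (\<lambda>x. (- 1) ^ n * fact (2 * n) * poly (bump n) x)"
    by auto
  also have "(- 1) ^ n * integral {0..1} (\<lambda>x. (- 1) ^ n * fact (2 * n) * poly (bump n) x) =
      fact (2 * n) * integral {0..1} (poly (bump n))"
    by (simp flip: power_mult_distrib mult.assoc)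
  also have "\<dots> = (fact n)\<^sup>2 / real (2 * n + 1)"
    by (simp add: integral_bump)
  finally show ?thesis .
qed

text \<open>Derivatives are taken within \<open>{0..1}\<close>, so agreement on that interval at
  order \<open>j\<close> determines the next derivative there, including the one-sided ones at 0 and
  1. The implication \<open>der\<close> therefore drives the induction for
  \<open>eq\<close>.\<close>

lemma nderiv01_poly:
  assumes "x \<in> {0..1}"
  shows "nderiv01 j (\<lambda>x. complex_of_real (poly p x)) x = complex_of_real (poly ((pderiv ^^ j) p) x)" (is ?eq)
    and "(nderiv01 j (\<lambda>x. complex_of_real (poly p x)) has_vector_derivative
            complex_of_real (poly ((pderiv ^^ Suc j) p) x)) (at x within {0..1})" (is ?der)
proof -
  have der: "(nderiv01 j (\<lambda>x. complex_of_real (poly p x)) has_vector_derivative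
      complex_of_real (poly ((pderiv ^^ Suc j) p) x)) (at x within {0..1})"
    if eq: "\<And>x. x \<in> {0..1} \<Longrightarrow> nderiv01 j (\<lambda>x. complex_of_real (poly p x)) x =
      complex_of_real (poly ((pderiv ^^ j) p) x)" and x: "x \<in> {0..1}" for j x
  proof (rule has_vector_derivative_transform[OF x])
    show "((\<lambda>x. complex_of_real (poly ((pderiv ^^ j) p) x)) has_vector_derivative
        complex_of_real (poly ((pderiv ^^ Suc j) p) x)) (at x within {0..1})"
      by (auto intro!: has_vector_derivative_of_real has_field_derivative_at_within poly_DERIV
          simp flip: has_real_derivative_iff_has_vector_derivative)
  qed (use eq in auto)
  have eq: "nderiv01 j (\<lambda>x. complex_of_real (poly p x)) x = complex_of_real (poly ((pderiv ^^ j) p) x)"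
    if "x \<in> {0..1}" for j x
    using that
  proof (induction j arbitrary: x)
    case (Suc j)
    then show ?case
      using vector_derivative_within_cbox[of 0 1 x, OF _ _ der[unfolded cbox_interval[symmetric]]] by simp
  qed simp
  show ?eq ?der
    using eq der assms by blast+
qed

text \<open>The two quotients are the squared L^2 norms of \<open>bump n\<close> and of its n-th
  derivative.\<close>

lemma wirtinger_bound_ge:
  assumes "wirtinger_bound n C"
  shows "(fact (2 * n))\<^sup>2 / fact (4 * n + 1) \<le> C * ((fact n)\<^sup>2 / real (2 * n + 1))"
proof -
  define u where "u = (\<lambda>x. complex_of_real (poly (bump n) x))"
  have "Ck01 n u"
    unfolding Ck01_def
  proof (intro conjI allI impI)
    show "nderiv01 j u differentiable_on {0..1}" for j
      unfolding differentiable_on_def u_def using nderiv01_poly(2) by (blast intro: differentiableI_vector)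
    then show "continuous_on {0..1} (nderiv01 n u)"
      by (rule differentiable_imp_continuous_on)
  qed
  moreover have "dirichlet01 n u"
    unfolding dirichlet01_def u_def by (simp add: nderiv01_poly(1) higher_pderiv_bump_boundary)
  ultimately have "integral {0..1} (\<lambda>x. (cmod (u x))\<^sup>2) \<le> C * integral {0..1} (\<lambda>x. (cmod (nderiv01 n u x))\<^sup>2)"
    using assms by (auto simp: wirtinger_bound_def)
  also have "integral {0..1} (\<lambda>x. (cmod (u x))\<^sup>2) = integral {0..1} (poly (bump n * bump n))"
    by (intro integral_cong) (simp add: u_def power2_eq_square)
  also have "integral {0..1} (\<lambda>x. (cmod (nderiv01 n u x))\<^sup>2) =
      integral {0..1} (poly ((pderiv ^^ n) (bump n) * (pderiv ^^ n) (bump n)))"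
    by (intro integral_cong) (simp add: u_def nderiv01_poly(1) power2_eq_square)
  finally show ?thesis
    unfolding integral_bump_square integral_higher_pderiv_bump_square .
qed

section \<open>Existence of the best constant and two-sided bounds\<close>

lemma wirtinger_bound_upper:
  assumes "n \<ge> 1"
  shows "wirtinger_bound n ((fact (2 * n - 1))\<^sup>2 / (fact (4 * n - 1) * real (2 * n - 1) * (fact (n - 1))\<^sup>2))"
  unfolding wirtinger_bound_def
  using clamped_Wirtinger[OF Ck01_clamped assms] by simp

text \<open>For fixed \<open>u\<close> the condition on C is A \<le> C B with B \<ge> 0. If B > 0,
  then A / B is a lower bound of the set; if B = 0, any admissible C already gives A \<le>
  0.\<close>

lemma wirtinger_bound_Inf:
  assumes "{C. wirtinger_bound n C} \<noteq> {}"
  shows "wirtinger_bound n (Inf {C. wirtinger_bound n C})"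
proof -
  define K where "K = Inf {C. wirtinger_bound n C}"
  have "wirtinger_bound n K"
    unfolding wirtinger_bound_def
  proof (intro allI impI)
    fix u assume u: "Ck01 n u \<and> dirichlet01 n u"
    define A B where "A = integral {0..1} (\<lambda>x. (cmod (u x))\<^sup>2)"
      and "B = integral {0..1} (\<lambda>x. (cmod (nderiv01 n u x))\<^sup>2)"
    have AB: "A \<le> C * B" if "wirtinger_bound n C" for C
      using that u by (auto simp: wirtinger_bound_def A_def B_def)
    have "B \<ge> 0"
      unfolding B_def by (intro Henstock_Kurzweil_Integration.integral_nonneg integrable_continuous_interval
          continuous_intros) (use u in \<open>auto simp: Ck01_def\<close>)
    have "A \<le> K * B"
    proof (cases "B = 0")
      case True
      then show ?thesis
        using AB assms by auto
    next
      case False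
      with \<open>B \<ge> 0\<close> have "B > 0" by simp
      then have "A / B \<le> K"
        using AB assms unfolding K_def by (intro cInf_greatest) (auto simp: field_simps)
      then show ?thesis
        using \<open>B > 0\<close> by (simp add: field_simps)
    qed
    then show "integral {0..1} (\<lambda>x. (cmod (u x))\<^sup>2) \<le>
        K * integral {0..1} (\<lambda>x. (cmod (nderiv01 n u x))\<^sup>2)"
      by (simp add: A_def B_def)
  qed
  then show ?thesis
    by (simp add: K_def)
qed

text \<open>\<open>LEAST\<close> over the reals is meaningful only if a minimum exists. The trial
  function bounds the admissible constants from below, so their infimum is real, and it is itself
  admissible.\<close>

lemma wirtinger_bound_Least:
  assumes "wirtinger_bound n C"
  shows "wirtinger_bound n (LEAST C. wirtinger_bound n C)" "(LEAST C. wirtinger_bound n C) \<le> C"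
proof -
  have "(fact (2 * n))\<^sup>2 / fact (4 * n + 1) / ((fact n)\<^sup>2 / real (2 * n + 1)) \<le> C'"
    if "wirtinger_bound n C'" for C'
    using wirtinger_bound_ge[OF that] by (subst pos_divide_le_eq) auto
  then have bdd: "bdd_below {C. wirtinger_bound n C}"
    by (intro bdd_belowI[where m="(fact (2 * n))\<^sup>2 / fact (4 * n + 1) / ((fact n)\<^sup>2 / real (2 * n + 1))"]) auto
  have Inf: "wirtinger_bound n (Inf {C. wirtinger_bound n C})"
    using assms by (intro wirtinger_bound_Inf) auto
  then have eq: "(LEAST C. wirtinger_bound n C) = Inf {C. wirtinger_bound n C}"
    by (rule Least_equality) (use bdd in \<open>auto intro: cInf_lower\<close>)
  show "wirtinger_bound n (LEAST C. wirtinger_bound n C)" "(LEAST C. wirtinger_bound n C) \<le> C"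
    unfolding eq using Inf assms bdd by (auto intro: cInf_lower)
qed

text \<open>These are the reciprocals of the trace bound and of the trial quotient. Both prefactors
  of \<open>F\<close> tend to 2, which fixes the leading order of \<open>c_const n\<close>.\<close>

lemma c_const_bounds:
  assumes "n \<ge> 1"
  defines "F \<equiv> fact (4 * n) * (fact n)\<^sup>2 / (fact (2 * n))\<^sup>2"
  shows "(2 * real n - 1) / real n * F \<le> c_const n"
    and "c_const n \<le> (4 * real n + 1) / (2 * real n + 1) * F"
proof -
  define K where "K = (LEAST C. wirtinger_bound n C)"
  define L where "L = (fact (2 * n))\<^sup>2 / fact (4 * n + 1) / ((fact n)\<^sup>2 / real (2 * n + 1))"
  define H where "H = (fact (2 * n - 1))\<^sup>2 / (fact (4 * n - 1) * real (2 * n - 1) * (fact (n - 1))\<^sup>2)"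
  note K = wirtinger_bound_Least[OF wirtinger_bound_upper[OF assms(1)], folded K_def H_def]
  have "L \<le> K"
    unfolding L_def using wirtinger_bound_ge[OF K(1)] by (subst pos_divide_le_eq) auto
  moreover have "L > 0"
    by (simp add: L_def)
  ultimately have c: "1 / H \<le> c_const n" "c_const n \<le> 1 / L"
    using K(2) by (auto simp: c_const_def K_def[symmetric] intro!: divide_left_mono)
  have "1 / L = (4 * real n + 1) / (2 * real n + 1) * F"
    by (simp add: L_def F_def field_simps)
  with c show "c_const n \<le> (4 * real n + 1) / (2 * real n + 1) * F"
    by simp
  have f: "fact (4 * n - 1) = fact (4 * n) / (4 * real n)" "fact (2 * n - 1) = fact (2 * n) / (2 * real n)"
    "fact (n - 1) = fact n / real n" "real (2 * n - 1) = 2 * real n - 1"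
    using assms(1) fact_reduce[of "4 * n", where 'a=real] fact_reduce[of "2 * n", where 'a=real]
      fact_reduce[of n, where 'a=real] by auto
  have "1 / ((b / (2 * x))\<^sup>2 / (a / (4 * x) * (2 * x - 1) * (d / x)\<^sup>2)) = (2 * x - 1) / x * (a * d\<^sup>2 / b\<^sup>2)"
    if "x > 0" "b > 0" for a b d x :: real
    using that by (simp add: field_simps power2_eq_square)
  then have "1 / H = (2 * real n - 1) / real n * F"
    unfolding H_def F_def f using assms(1) by simp
  with c show "(2 * real n - 1) / real n * F \<le> c_const n"
    by simp
qed

section \<open>Stirling's formula with an explicit error\<close>

text \<open>For \<open>n \<ge> 1\<close> this is the logarithm of n! / (sqrt n (n/e)^n), which tends
  to ln (sqrt (2 pi)).\<close>

definition stirling_defect :: "nat \<Rightarrow> real" where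
  "stirling_defect n = ln (fact n) - (real n + 1/2) * ln (real n) + real n"

lemma ln_fact_eq: "ln (fact n) = stirling_defect n + (real n + 1/2) * ln (real n) - real n"
  by (simp add: stirling_defect_def)

text \<open>The decrease is (x + 1/2) l - 1, where l is the integral of 1/t from x to x + 1. By
  convexity the midpoint rule bounds l from below and the trapezoidal rule from above; the latter
  leaves the telescoping term 1/(4x) - 1/(4(x+1)).\<close>

lemma stirling_defect_step:
  assumes "n \<ge> 1"
  shows "stirling_defect (Suc n) \<le> stirling_defect n"
    and "stirling_defect n - 1 / (4 * real n) \<le> stirling_defect (Suc n) - 1 / (4 * real (Suc n))"
proof -
  define x l where "x = real n" and "l = ln (x + 1) - ln x"
  have x: "x > 0"
    using assms by (simp add: x_def)
  have "ln (fact (Suc n)) = ln (x + 1) + ln (fact n)"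
    by (simp add: x_def ln_mult add.commute)
  then have d: "stirling_defect n - stirling_defect (Suc n) = (x + 1/2) * l - 1"
    by (simp add: stirling_defect_def l_def x_def algebra_simps)
  have "l \<ge> 2 / (2 * x + 1)"
    using ln_inverse_approx_ge[of x "x + 1"] x by (simp add: l_def)
  then have "(x + 1/2) * l \<ge> (x + 1/2) * (2 / (2 * x + 1))"
    using x by (intro mult_left_mono) auto
  moreover have "(x + 1/2) * (2 / (2 * x + 1)) = 1"
    using x by (simp add: field_simps)
  ultimately show "stirling_defect (Suc n) \<le> stirling_defect n"
    using d by linarith
  have "l \<le> (inverse x + inverse (x + 1)) / 2"
    using ln_inverse_approx_le[of x 1] x by (simp add: l_def)
  then have "(x + 1/2) * l \<le> (x + 1/2) * ((inverse x + inverse (x + 1)) / 2)"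
    using x by (intro mult_left_mono) auto
  moreover have "(x + 1/2) * ((inverse x + inverse (x + 1)) / 2) - 1 = 1 / (4 * x) - 1 / (4 * (x + 1))"
    using x by (simp add: divide_simps) (simp add: algebra_simps)
  ultimately show "stirling_defect n - 1 / (4 * real n) \<le> stirling_defect (Suc n) - 1 / (4 * real (Suc n))"
    using d unfolding x_def[symmetric] of_nat_Suc add.commute[of 1] by linarith
qed

lemma stirling_defect_mono:
  assumes "1 \<le> m" "m \<le> n"
  shows "stirling_defect n \<le> stirling_defect m"
    and "stirling_defect m - 1 / (4 * real m) \<le> stirling_defect n - 1 / (4 * real n)"
proof -
  show "stirling_defect n \<le> stirling_defect m"
    using assms(2)
    by (induction rule: dec_induct) (use assms(1) stirling_defect_step(1) in \<open>auto intro: order_trans\<close>)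
  show "stirling_defect m - 1 / (4 * real m) \<le> stirling_defect n - 1 / (4 * real n)"
    using assms(2)
    by (induction rule: dec_induct) (use assms(1) stirling_defect_step(2) in \<open>auto intro: order_trans\<close>)
qed

lemma convergent_stirling_defect: "convergent stirling_defect"
proof -
  have "stirling_defect 1 - 1 / 4 \<le> stirling_defect (Suc n)" for n
  proof -
    have "0 \<le> 1 / (4 * real (Suc n))" by simp
    moreover have "stirling_defect 1 - 1 / 4 \<le> stirling_defect (Suc n) - 1 / (4 * real (Suc n))"
      using stirling_defect_mono(2)[of 1 "Suc n"] by simp
    ultimately show ?thesis by linarith
  qed
  moreover have "decseq (\<lambda>n. stirling_defect (Suc n))"
    by (intro decseq_SucI stirling_defect_step) simp
  ultimately obtain L where "(\<lambda>n. stirling_defect (Suc n)) \<longlonglongrightarrow> L"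
    using decseq_convergent by blast
  then show ?thesis
    by (auto simp: convergent_def intro: LIMSEQ_imp_Suc)
qed

text \<open>In the closed form (2^n n!)^4 / ((2n)!^2 (2n+1)) of the partial product, the terms of
  order n ln n and n cancel, so Wallis's product determines the limit of the defect.\<close>

lemma ln_Wallis_product:
  assumes "n \<ge> 1"
  shows "ln (\<Prod>k=1..n. (4 * real k ^ 2) / (4 * real k ^ 2 - 1)) =
    4 * stirling_defect n - 2 * stirling_defect (2 * n) + ln (real n / (2 * real n + 1)) - ln 2"
proof -
  have "(\<Prod>k=1..n. (4 * real k ^ 2) / (4 * real k ^ 2 - 1)) =
      (2 ^ n * fact n) ^ 4 / ((fact (2 * n))\<^sup>2 * (2 * real n + 1))" for n
  proof (induction n)
    case (Suc n)
    define x a b p where "x = real n" and "a = (fact n :: real)" and "b = (fact (2 * n) :: real)"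
      and "p = (2::real) ^ n"
    have pos: "x \<ge> 0" "a > 0" "b > 0" "p > 0"
      by (auto simp: x_def a_def b_def p_def)
    have "(fact (2 * Suc n) :: real) = (2 * x + 2) * (2 * x + 1) * b"
      by (simp add: x_def b_def algebra_simps)
    moreover have "(fact (Suc n) :: real) = (x + 1) * a"
      by (simp add: x_def a_def add.commute)
    moreover have "(p * a) ^ 4 / (b\<^sup>2 * (2 * x + 1)) * ((4 * (x + 1) ^ 2) / (4 * (x + 1) ^ 2 - 1)) =
        (2 * p * ((x + 1) * a)) ^ 4 / (((2 * x + 2) * (2 * x + 1) * b)\<^sup>2 * (2 * (x + 1) + 1))"
    proof -
      have e: "4 * (x + 1) ^ 2 - 1 = (2 * x + 1) * (2 * x + 3)" "2 * x + 2 = 2 * (x + 1)"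
        "2 * (x + 1) + 1 = 2 * x + 3"
        by (simp_all add: power2_eq_square algebra_simps)
      have "(p * a) ^ 4 / (b\<^sup>2 * v) * ((4 * y ^ 2) / (v * w)) =
          (2 * p * (y * a)) ^ 4 / ((2 * y * v * b)\<^sup>2 * w)" if "y > 0" "v > 0" "w > 0" for y v w :: real
        using that pos by (simp add: field_simps power2_eq_square power4_eq_xxxx)
      then show ?thesis
        unfolding e using pos by auto
    qed
    ultimately show ?case
      using Suc.IH by (simp add: x_def a_def b_def p_def add.commute)
  qed simp
  then have "ln (\<Prod>k=1..n. (4 * real k ^ 2) / (4 * real k ^ 2 - 1)) =
      4 * (real n * ln 2 + ln (fact n)) - (2 * ln (fact (2 * n)) + ln (2 * real n + 1))"
    by (simp add: ln_div ln_mult ln_realpow)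
  then show ?thesis
    using assms unfolding ln_fact_eq by (simp add: ln_div ln_mult algebra_simps)
qed

lemma stirling_defect_LIMSEQ: "stirling_defect \<longlonglongrightarrow> ln (2 * pi) / 2"
proof -
  obtain s where s: "stirling_defect \<longlonglongrightarrow> s"
    using convergent_stirling_defect by (auto simp: convergent_def)
  have "(\<lambda>n. ln (\<Prod>k=1..n. (4 * real k ^ 2) / (4 * real k ^ 2 - 1))) \<longlonglongrightarrow> ln (pi / 2)"
    by (intro tendsto_ln wallis) auto
  then have "(\<lambda>n. 4 * stirling_defect n - 2 * stirling_defect (2 * n) + ln (real n / (2 * real n + 1)) - ln 2)
      \<longlonglongrightarrow> ln (pi / 2)"
    by (rule Lim_transform_eventually) (intro eventually_mono[OF eventually_ge_at_top[of 1]] ln_Wallis_product)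
  \<comment> \<open>The defects at \<open>n\<close> and \<open>2 * n\<close> share the limit s, so
    comparison with ln (pi / 2) leaves a linear equation for s.\<close>
  moreover have "(\<lambda>n. 4 * stirling_defect n - 2 * stirling_defect (2 * n) + ln (real n / (2 * real n + 1)) - ln 2)
      \<longlonglongrightarrow> 4 * s - 2 * s + ln (1 / 2) - ln 2"
  proof -
    have s2: "(\<lambda>n. stirling_defect (2 * n)) \<longlonglongrightarrow> s"
      by (rule filterlim_compose[OF s]) (auto intro!: filterlim_subseq simp: strict_mono_def)
    have "(\<lambda>n. inverse (2 + inverse (real n))) \<longlonglongrightarrow> inverse (2 + 0)"
      by (intro tendsto_intros lim_inverse_n) auto
    moreover have "eventually (\<lambda>n. inverse (2 + inverse (real n)) = real n / (2 * real n + 1)) at_top"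
      using eventually_gt_at_top[of 0] by eventually_elim (auto simp: field_simps)
    ultimately have "(\<lambda>n. real n / (2 * real n + 1)) \<longlonglongrightarrow> 1 / 2"
      by (auto simp: inverse_eq_divide dest: Lim_transform_eventually)
    then show ?thesis
      by (intro tendsto_add tendsto_diff tendsto_mult tendsto_ln tendsto_const s s2) auto
  qed
  ultimately have "ln (pi / 2) = 4 * s - 2 * s + ln (1 / 2) - ln 2"
    by (rule LIMSEQ_unique)
  then have "s = ln (2 * pi) / 2"
    by (simp add: ln_div ln_mult)
  with s show ?thesis by simp
qed

text \<open>The defect decreases to its limit, while the defect minus 1/(4n) increases to the same
  limit.\<close>

lemma stirling_defect_bounds:
  assumes "n \<ge> 1"
  shows "ln (2 * pi) / 2 \<le> stirling_defect n" "stirling_defect n \<le> ln (2 * pi) / 2 + 1 / (4 * real n)"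
proof -
  show "ln (2 * pi) / 2 \<le> stirling_defect n"
    by (rule LIMSEQ_le_const2[OF stirling_defect_LIMSEQ]) (use stirling_defect_mono(1)[OF assms] in auto)
  have "stirling_defect n - 1 / (4 * real n) \<le> stirling_defect m" if "n \<le> m" for m
  proof -
    have "0 \<le> 1 / (4 * real m)" by simp
    with stirling_defect_mono(2)[OF assms that] show ?thesis by linarith
  qed
  then have "stirling_defect n - 1 / (4 * real n) \<le> ln (2 * pi) / 2"
    by (intro LIMSEQ_le_const[OF stirling_defect_LIMSEQ]) auto
  then show "stirling_defect n \<le> ln (2 * pi) / 2 + 1 / (4 * real n)"
    by simp
qed

section \<open>Asymptotics of the factorial quotient and of the best constant\<close>

lemma factorial_quotient_asymptotics:
  assumes "n \<ge> 1"
  defines "\<rho> \<equiv> 2 * (fact (4 * n) * (fact n)\<^sup>2 / (fact (2 * n))\<^sup>2) /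
    (sqrt (8 * pi * real n) * (4 * real n / exp 1) ^ (2 * n))"
  shows "exp (- (1 / real n)) \<le> \<rho>" "\<rho> \<le> exp (1 / real n)"
proof -
  define \<delta> where "\<delta> k = stirling_defect k - ln (2 * pi) / 2" for k
  have n: "real n > 0" "n > 0"
    using assms by auto
  have \<delta>: "0 \<le> \<delta> k" "\<delta> k \<le> 1 / (4 * real k)" if "k \<ge> 1" for k
    using stirling_defect_bounds[OF that] by (auto simp: \<delta>_def)
  have "ln \<rho> = ln 2 + ln (fact (4 * n)) + 2 * ln (fact n) - 2 * ln (fact (2 * n))
      - (ln (8 * pi * real n) / 2 + 2 * real n * (ln (4 * real n) - 1))"
    unfolding \<rho>_def using n by (simp add: ln_div ln_mult ln_realpow ln_sqrt algebra_simps)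
  also have "\<dots> = \<delta> (4 * n) + 2 * \<delta> n - 2 * \<delta> (2 * n)"
  proof -
    have l: "ln (4 * real n) = 2 * ln 2 + ln (real n)" "ln (8 * pi * real n) = 3 * ln 2 + ln pi + ln (real n)"
      "ln (2 * real n) = ln 2 + ln (real n)" "ln (2 * pi) = ln 2 + ln pi"
      using n ln_realpow[of 2 2] ln_realpow[of 2 3] by (simp_all add: ln_mult)
    show ?thesis
      unfolding ln_fact_eq \<delta>_def by (simp add: l) (simp add: field_simps)
  qed
  finally have "ln \<rho> = \<delta> (4 * n) + 2 * \<delta> n - 2 * \<delta> (2 * n)" .
  moreover define e where "e = 1 / real n"
  \<comment> \<open>These bounds place the logarithm between - e / 4 and 9 e / 16, hence between - e
    and e.\<close>
  moreover have "\<delta> (4 * n) \<ge> 0" "\<delta> n \<ge> 0" "\<delta> (2 * n) \<ge> 0"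
    "\<delta> (4 * n) \<le> e / 16" "\<delta> n \<le> e / 4" "\<delta> (2 * n) \<le> e / 8"
    using \<delta>[of "4 * n"] \<delta>[of n] \<delta>[of "2 * n"] assms(1) by (auto simp: e_def)
  moreover have "e > 0"
    using n by (simp add: e_def)
  ultimately have "- (1 / real n) \<le> ln \<rho>" "ln \<rho> \<le> 1 / real n"
    by linarith+
  moreover have "\<rho> > 0"
    unfolding \<rho>_def using n by auto
  ultimately show "exp (- (1 / real n)) \<le> \<rho>" "\<rho> \<le> exp (1 / real n)"
    by (metis exp_le_cancel_iff exp_ln)+
qed

text \<open>After division by 2 the prefactors in \<open>c_const_bounds\<close> are (4n+1)/(4n+2) <
  1 and 1 - 1/(2n), so the factorial quotient estimate loses at most another error of order
  1/n.\<close>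

lemma c_const_relative_error:
  assumes "n \<ge> 1"
  defines "S \<equiv> sqrt (8 * pi * real n) * (4 * real n / exp 1) ^ (2 * n)"
  shows "\<bar>c_const n / S - 1\<bar> \<le> 2 / real n"
proof -
  define F :: real where "F = fact (4 * n) * (fact n)\<^sup>2 / (fact (2 * n))\<^sup>2"
  define \<rho> where "\<rho> = 2 * F / S"
  define e where "e = 1 / real n"
  have n: "real n > 0"
    using assms(1) by simp
  have e: "0 < e" "e \<le> 1"
    using assms(1) by (auto simp: e_def)
  have S: "S > 0"
    unfolding S_def using n by auto
  have \<rho>: "exp (- e) \<le> \<rho>" "\<rho> \<le> exp e"
    using factorial_quotient_asymptotics[OF assms(1)] by (simp_all add: \<rho>_def F_def S_def e_def)
  have "\<rho> > 0"
    using \<rho>(1) exp_gt_zero[of "- e"] by linarith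
  have "c_const n / S \<le> (4 * real n + 1) / (2 * real n + 1) * F / S"
    unfolding F_def using c_const_bounds(2)[OF assms(1)] S by (intro divide_right_mono) auto
  also have "\<dots> = (4 * real n + 1) / (4 * real n + 2) * \<rho>"
  proof -
    have "b / c * f / s = b / (2 * c) * (2 * f / s)" if "c > 0" "s > 0" for b c f s :: real
      using that by (simp add: field_simps)
    from this[of "2 * real n + 1" S "4 * real n + 1" F] show ?thesis
      using S n by (simp add: \<rho>_def distrib_left)
  qed
  also have "\<dots> \<le> 1 * \<rho>"
    using \<open>\<rho> > 0\<close> n by (intro mult_right_mono) auto
  also have "\<dots> \<le> 1 + e + e\<^sup>2"
    using \<rho>(2) exp_bound[of e] e by simp
  also have "\<dots> \<le> 1 + 2 * e"
    using e mult_left_le[of e e] by (simp add: power2_eq_square)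
  finally have upper: "c_const n / S - 1 \<le> 2 * e"
    by simp
  \<comment> \<open>Here 1 - e bounds \<open>exp (- e)\<close> from below, and 1 - e / 2 is half of
    the prefactor \<open>(2 * real n - 1) / real n\<close>.\<close>
  have "(1 - e / 2) * (1 - e) \<le> (1 - e / 2) * \<rho>"
    using e \<rho>(1) exp_ge_add_one_self[of "- e"] by (intro mult_left_mono) auto
  also have "\<dots> = (2 * real n - 1) / real n * F / S"
  proof -
    have "(1 - 1 / x / 2) * (2 * f / s) = (2 * x - 1) / x * f / s" if "x > 0" "s > 0" for x f s :: real
      using that by (simp add: field_simps)
    then show ?thesis
      unfolding \<rho>_def e_def using S n by simp
  qed
  also have "\<dots> \<le> c_const n / S"
    unfolding F_def using c_const_bounds(1)[OF assms(1)] S by (intro divide_right_mono) auto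
  finally have "(1 - e / 2) * (1 - e) \<le> c_const n / S" .
  moreover have "(1 - e / 2) * (1 - e) = 1 - 2 * e + e / 2 + e * e / 2"
    by (simp add: field_simps)
  moreover have "e * e \<ge> 0"
    by simp
  ultimately have "1 - 2 * e \<le> c_const n / S"
    using e by linarith
  with upper show ?thesis
    by (simp add: e_def abs_le_iff)
qed

theorem mainTheorem1:
  "(\<exists>r :: nat \<Rightarrow> real. r \<in> O(\<lambda>\<alpha>. 1 / sqrt (real \<alpha>)) \<and>
      (\<forall>\<alpha>\<ge>1. c_const \<alpha> =
         sqrt (8 * pi * real \<alpha>) * (4 * real \<alpha> / exp 1) ^ (2 * \<alpha>) * (1 + r \<alpha>))) \<and>
   (\<forall>\<alpha>\<ge>1.
      (4 * real \<alpha> - 2) / (4 * (real \<alpha>)\<^sup>2 - real \<alpha>)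
          * (fact (4 * \<alpha>) * (fact \<alpha>)\<^sup>2 / (fact (2 * \<alpha>))\<^sup>2) \<le> c_const \<alpha> \<and>
      c_const \<alpha> \<le> (4 * real \<alpha> + 1) / (2 * real \<alpha> + 1)
          * (fact (4 * \<alpha>) * (fact \<alpha>)\<^sup>2 / (fact (2 * \<alpha>))\<^sup>2))"
proof (intro conjI allI impI)
  define S where "S n = sqrt (8 * pi * real n) * (4 * real n / exp 1) ^ (2 * n)" for n
  define r where "r n = c_const n / S n - 1" for n
  have "norm (r n) \<le> 2 * norm (1 / sqrt (real n))" if "n \<ge> 1" for n
  proof -
    have "norm (r n) \<le> 2 / real n"
      using c_const_relative_error[OF that] by (simp add: r_def S_def)
    also have "\<dots> \<le> 2 / sqrt (real n)"
      using that by (intro divide_left_mono real_le_lsqrt) (auto simp: power2_eq_square)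
    finally show ?thesis
      using that by simp
  qed
  then have "r \<in> O(\<lambda>n. 1 / sqrt (real n))"
    by (intro bigoI[of _ 2] eventually_mono[OF eventually_ge_at_top[of 1]])
  moreover have "c_const n = S n * (1 + r n)" if "n \<ge> 1" for n
  proof -
    have "S n > 0"
      unfolding S_def using that by auto
    then show ?thesis
      by (simp add: r_def)
  qed
  ultimately show "\<exists>r :: nat \<Rightarrow> real. r \<in> O(\<lambda>\<alpha>. 1 / sqrt (real \<alpha>)) \<and>
      (\<forall>\<alpha>\<ge>1. c_const \<alpha> =
         sqrt (8 * pi * real \<alpha>) * (4 * real \<alpha> / exp 1) ^ (2 * \<alpha>) * (1 + r \<alpha>))"
    unfolding S_def by blast
next
  fix \<alpha> :: nat
  assume \<alpha>: "\<alpha> \<ge> 1"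
  define x where "x = real \<alpha>"
  have x: "x \<ge> 1"
    using \<alpha> by (simp add: x_def)
  have "(4 * x - 2) / (4 * x\<^sup>2 - x) = (2 * x - 1) / x * (2 / (4 * x - 1))"
    using x by (simp add: field_simps power2_eq_square)
  \<comment> \<open>The required lower bound is the trace bound times 2 / (4x - 1), which is at most
    2/3 since x \<ge> 1.\<close>
  also have "\<dots> \<le> (2 * x - 1) / x * 1"
    using x by (intro mult_left_mono) auto
  finally have "(4 * x - 2) / (4 * x\<^sup>2 - x) * (fact (4 * \<alpha>) * (fact \<alpha>)\<^sup>2 / (fact (2 * \<alpha>))\<^sup>2) \<le>
      (2 * x - 1) / x * (fact (4 * \<alpha>) * (fact \<alpha>)\<^sup>2 / (fact (2 * \<alpha>))\<^sup>2)"
    by (intro mult_right_mono) auto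
  also have "\<dots> \<le> c_const \<alpha>"
    unfolding x_def by (rule c_const_bounds(1)[OF \<alpha>])
  finally show "(4 * real \<alpha> - 2) / (4 * (real \<alpha>)\<^sup>2 - real \<alpha>)
      * (fact (4 * \<alpha>) * (fact \<alpha>)\<^sup>2 / (fact (2 * \<alpha>))\<^sup>2) \<le> c_const \<alpha>"
    by (simp only: x_def)
qed (rule c_const_bounds(2))

end
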